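(* Let $m\ge 2$ and $n\ge 2$. Then $\mathrm{f}\mu^{k}(K_m\,\square\,K_n)=z(m,n;2,2)$ if $k=0$, $\mathrm{f}\mu^{k}(K_m\,\square\,K_n)=m+n-2$ if $k=1$, and $\mathrm{f}\mu^{k}(K_m\,\square\,K_n)=\max\{m,n\}$ if $k\ge 2$.
   Context: For an integer $k\ge 0$ and a connected graph $G$, a set $X\subseteq V(G)$ is a $k$-fault-tolerant mutual-visibility set ($k$-ftmv set) if for any two non-adjacent vertices $u,v\in X$ there exist $k+1$ internally vertex-disjoint shortest $u,v$-paths $Q_1,\dots,Q_{k+1}$ in $G$ such that $V(Q_i)\cap X=\{u,v\}$ for every $i$. $\mathrm{f}\mu^{k}(G)$ denotes the maximum cardinality of a $k$-ftmv set of $G$. $K_n$ is the complete graph on $n$ vertices and $G\,\square\,H$ is the Cartesian product: vertex set $V(G)\times V(H)$, with $(g,h)\sim(g',h')$ iff either $g=g'$ and $hh'\in E(H)$, or $gg'\in E(G)$ and $h=h'$. $z(m,n;2,2)$ is the maximum number of entries equal to $1$ in an $m\times n$ binary matrix that contains no $2\times 2$ submatrix (formed by any two rows and any two columns) consisting of four $1$s. *)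

theory Defs
  imports "Graph_Theory.Graph_Theory" "Jordan_Normal_Form.Matrix"
begin

text \<open>
  Simple graphs are the symmetric loop-free digraphs of the Graph Theory library, and paths are
  represented by their vertex sequences (\<^const>\<open>vpath\<close>).
\<close>

definition cartesian_product ::
    "'a pair_pre_digraph \<Rightarrow> 'b pair_pre_digraph \<Rightarrow> ('a \<times> 'b) pair_pre_digraph"
    (infixr \<open>\<box>\<close> 70) where
  "G \<box> H = \<lparr> pverts = pverts G \<times> pverts H,
     parcs = {((g, h), (g', h')).
       g \<in> pverts G \<and> g = g' \<and> (h, h') \<in> parcs H \<or>
       (g, g') \<in> parcs G \<and> h \<in> pverts H \<and> h = h'} \<rparr>"

definition shortest_vpath :: "('a, 'b) pre_digraph \<Rightarrow> 'a \<Rightarrow> 'a \<Rightarrow> 'a vwalk \<Rightarrow> bool" where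
  "shortest_vpath G u v p \<longleftrightarrow>
     vpath p G \<and> hd p = u \<and> last p = v \<and>
     (\<forall>q. vpath q G \<and> hd q = u \<and> last q = v \<longrightarrow> vwalk_length p \<le> vwalk_length q)"

text \<open>
  Two paths between distinct \<open>u\<close> and \<open>v\<close> are internally vertex-disjoint iff they have exactly the
  vertices \<open>u\<close> and \<open>v\<close> in common. As \<open>u\<close> and \<open>v\<close> are moreover non-adjacent, every path between
  them has an internal vertex, so the paths \<open>Q 0, \<dots>, Q k\<close> below are automatically distinct.
  The notion is meant for connected \<open>G\<close>.
\<close>

definition ftmv_set :: "nat \<Rightarrow> ('a, 'b) pre_digraph \<Rightarrow> 'a set \<Rightarrow> bool" where
  "ftmv_set k G X \<longleftrightarrow> X \<subseteq> verts G \<and>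
     (\<forall>u\<in>X. \<forall>v\<in>X. u \<noteq> v \<and> (u, v) \<notin> arcs_ends G \<longrightarrow>
        (\<exists>Q :: nat \<Rightarrow> 'a vwalk.
           (\<forall>i\<le>k. shortest_vpath G u v (Q i) \<and> set (Q i) \<inter> X = {u, v}) \<and>
           (\<forall>i\<le>k. \<forall>j\<le>k. i \<noteq> j \<longrightarrow> set (Q i) \<inter> set (Q j) = {u, v})))"

definition ftmv_number :: "nat \<Rightarrow> ('a, 'b) pre_digraph \<Rightarrow> nat" where
  "ftmv_number k G = Max {card X | X. ftmv_set k G X}"

definition no_all_ones_2x2 :: "nat mat \<Rightarrow> bool" where
  "no_all_ones_2x2 A \<longleftrightarrow>
     \<not> (\<exists>i i' j j'. i < i' \<and> i' < dim_row A \<and> j < j' \<and> j' < dim_col A \<and>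
          A $$ (i, j) = 1 \<and> A $$ (i, j') = 1 \<and> A $$ (i', j) = 1 \<and> A $$ (i', j') = 1)"

text \<open>The Zarankiewicz number \<open>z(m, n; 2, 2)\<close>.\<close>

definition zarankiewicz22 :: "nat \<Rightarrow> nat \<Rightarrow> nat" where
  "zarankiewicz22 m n =
     Max {card {(i, j). i < m \<and> j < n \<and> A $$ (i, j) = 1} | A.
            A \<in> carrier_mat m n \<and> elements_mat A \<subseteq> {0, 1} \<and> no_all_ones_2x2 A}"

end

theory Submission
  imports Defs
begin

text \<open>
  Two non-adjacent vertices \<open>(a, b)\<close> and \<open>(c, d)\<close> of \<open>K\<^sub>m \<box> K\<^sub>n\<close> are joined by exactly two shortest
  paths, through the corners \<open>(a, d)\<close> and \<open>(c, b)\<close>. Hence for \<open>k = 0\<close> a fault-tolerant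
  mutual-visibility set is a set of matrix positions that contains no full \<open>2 \<times> 2\<close> submatrix.
  For \<open>k = 1\<close> no \<open>2 \<times> 2\<close> submatrix may have three chosen positions, so every chosen position is alone
  in its row or alone in its column, which bounds their number. For \<open>k \<ge> 2\<close> the set has to be a
  clique, that is, contained in a row or a column.
\<close>

section \<open>Extremal bounds for sets of grid positions\<close>

lemma Max_eqI_card:
  assumes "finite A" "\<And>X. P X \<Longrightarrow> X \<subseteq> A" "\<And>X. P X \<Longrightarrow> card X \<le> N" "P Y" "card Y = N"
  shows "Max {card X | X. P X} = N"
proof (rule Max_eqI)
  \<comment> \<open>\<open>Max\<close> is specified only for finite sets; the common superset
    \<open>A\<close> provides the finiteness.\<close>
  have "{card X | X. P X} \<subseteq> card ` Pow A" using assms(2) by auto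
  then show "finite {card X | X. P X}" using \<open>finite A\<close> by (meson finite_Pow_iff finite_imageI finite_subset)
qed (use assms in auto)

text \<open>If no row holds two positions, the projection to \<open>V\<close> is injective.
  Otherwise a third position must share a line with both \<open>(a, b)\<close> and
  \<open>(a, b')\<close>; it cannot lie in both columns, so everything lies in row \<open>a\<close>
  and the projection to \<open>W\<close> is injective.\<close>

lemma card_le_card_line:
  assumes "finite V" "finite W" "X \<subseteq> V \<times> W"
    and line: "\<And>a b c d. (a, b) \<in> X \<Longrightarrow> (c, d) \<in> X \<Longrightarrow> a = c \<or> b = d"
  shows "card X \<le> max (card V) (card W)"
proof (cases "inj_on fst X")
  case True
  then have "card X \<le> card V" using assms(1,3) by (intro card_inj_on_le[of fst]) auto
  then show ?thesis by simp
next
  case False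
  then obtain a b b' where ab: "(a, b) \<in> X" "(a, b') \<in> X" "b \<noteq> b'"
    unfolding inj_on_def by (metis prod.collapse)
  have "c = a" if "(c, d) \<in> X" for c d
    using line[OF that ab(1)] line[OF that ab(2)] ab(3) by auto
  then have "inj_on snd X" by (auto simp: inj_on_def)
  then have "card X \<le> card W" using assms(2,3) by (intro card_inj_on_le[of snd]) auto
  then show ?thesis by simp
qed

text \<open>The positions split into those alone in their column (\<open>C\<close>) and the rest
  (\<open>R\<close>), which are alone in their row. This gives the bound
  \<open>card V + card W\<close>; the missing 2 comes from looking at when one of the two counts is
  attained.\<close>

lemma card_le_if_no_three_corners:
  assumes "finite V" "finite W" "card V \<ge> 2" "card W \<ge> 2" "X \<subseteq> V \<times> W"
    and corners: "\<And>a b c d. (a, b) \<in> X \<Longrightarrow> (c, d) \<in> X \<Longrightarrow> a \<noteq> c \<Longrightarrow> b \<noteq> d \<Longrightarrow>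
      (a, d) \<notin> X \<and> (c, b) \<notin> X"
  shows "card X \<le> card V + card W - 2"
proof -
  define C where "C = {(a, b) \<in> X. \<forall>c. (c, b) \<in> X \<longrightarrow> c = a}"
  define R where "R = X - C"
  have R_row: "d = b" if "(a, b) \<in> R" "(a, d) \<in> X" for a b d
  proof (rule ccontr)
    assume "d \<noteq> b"
    \<comment> \<open>With a second position in column \<open>b\<close> and one in row
      \<open>a\<close>, the position \<open>(a, b)\<close> would be the third corner of a
      rectangle.\<close>
    obtain c where "(c, b) \<in> X" "c \<noteq> a" using \<open>(a, b) \<in> R\<close> by (auto simp: R_def C_def)
    then show False using corners[of c b a d] that \<open>d \<noteq> b\<close> by (auto simp: R_def)
  qed
  have sub: "C \<subseteq> X" "R \<subseteq> X" by (auto simp: C_def R_def)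
  have injC: "inj_on snd C" by (auto simp: inj_on_def C_def)
  have injR: "inj_on fst R" using R_row sub by (auto simp: inj_on_def)
  have subC: "snd ` C \<subseteq> W" and subR: "fst ` R \<subseteq> V" using sub assms(5) by auto
  have cardX: "card X = card C + card R"
    unfolding R_def using sub(1) finite_subset[OF assms(5)] assms(1,2)
    by (simp add: card_Diff_subset card_mono finite_subset)
  have leC: "card C \<le> card W" using card_inj_on_le[OF injC subC] assms(2) by simp
  have leR: "card R \<le> card V" using card_inj_on_le[OF injR subR] assms(1) by simp
  consider "card C = card W" | "card R = card V" | "card C < card W" "card R < card V"
    using leC leR by linarith
  then show ?thesis
  proof cases
    \<comment> \<open>If \<open>C\<close> meets every column, each column holds only its
      \<open>C\<close>-position, so \<open>R\<close> is empty and \<open>card V \<ge> 2\<close>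
      absorbs the loss of 2. Case 2 is symmetric, and in case 3 both counts drop by one.\<close>
    case 1
    then have "snd ` C = W"
      using subC card_image[OF injC] assms(2) by (simp add: card_subset_eq)
    have "x \<in> C" if "x \<in> X" for x
    proof -
      obtain a b where x: "x = (a, b)" by force
      then have "b \<in> snd ` C" using that assms(5) \<open>snd ` C = W\<close> by auto
      then obtain c where "(c, b) \<in> C" by auto
      then show ?thesis using that x by (auto simp: C_def)
    qed
    then have "R = {}" by (auto simp: R_def)
    then show ?thesis using cardX leC assms(3) by simp
  next
    case 2
    then have "fst ` R = V"
      using subR card_image[OF injR] assms(1) by (simp add: card_subset_eq)
    have "x \<in> R" if "x \<in> X" for x
    proof -
      obtain a b where x: "x = (a, b)" by force
      then have "a \<in> fst ` R" using that assms(5) \<open>fst ` R = V\<close> by auto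
      then obtain d where "(a, d) \<in> R" by auto
      then show ?thesis using R_row that x by blast
    qed
    then have "C = {}" using sub(1) by (auto simp: R_def)
    then show ?thesis using cardX leR assms(4) by simp
  next
    case 3
    then show ?thesis using cardX by linarith
  qed
qed

text \<open>Enumerations of \<open>V\<close> and \<open>W\<close> turn the positions of the ones of
  a matrix into a subset of the grid of equal size, and back. Both maxima therefore range over the
  same set of cardinalities.\<close>

lemma zarankiewicz22_eq_Max:
  assumes "finite V" "finite W"
  shows "zarankiewicz22 (card V) (card W) = Max {card X | X. X \<subseteq> V \<times> W \<and>
    (\<forall>a b c d. (a, b) \<in> X \<longrightarrow> (c, d) \<in> X \<longrightarrow> a \<noteq> c \<longrightarrow> b \<noteq> d \<longrightarrow> (a, d) \<notin> X \<or> (c, b) \<notin> X)}"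
    (is "_ = Max {card X | X. ?P X}")
proof -
  let ?m = "card V" and ?n = "card W"
  let ?ones = "\<lambda>A. {(i, j). i < ?m \<and> j < ?n \<and> A $$ (i, j) = (1 :: nat)}"
  let ?Q = "\<lambda>A. A \<in> carrier_mat ?m ?n \<and> elements_mat A \<subseteq> {0, 1} \<and> no_all_ones_2x2 A"
  obtain f g where f: "bij_betw f {..<?m} V" and g: "bij_betw g {..<?n} W"
    using ex_bij_betw_nat_finite[OF assms(1)] ex_bij_betw_nat_finite[OF assms(2)]
    by (auto simp: atLeast0LessThan)
  let ?h = "map_prod f g"
  have inj_h: "inj_on ?h ({..<?m} \<times> {..<?n})"
    using f g by (simp add: bij_betw_def map_prod_inj_on)
  have f_eq: "f i = f i' \<longleftrightarrow> i = i'" if "i < ?m" "i' < ?m" for i i'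
    using f that by (auto simp: bij_betw_def inj_on_def)
  have g_eq: "g j = g j' \<longleftrightarrow> j = j'" if "j < ?n" "j' < ?n" for j j'
    using g that by (auto simp: bij_betw_def inj_on_def)
  have fV: "f i \<in> V" if "i < ?m" for i using f that by (auto simp: bij_betw_def)
  have gW: "g j \<in> W" if "j < ?n" for j using g that by (auto simp: bij_betw_def)
  have "\<exists>X. card (?ones A) = card X \<and> ?P X" if "?Q A" for A
  proof (intro exI conjI allI impI)
    have "?ones A \<subseteq> {..<?m} \<times> {..<?n}" by auto
    then have "inj_on ?h (?ones A)" using inj_h by (rule inj_on_subset[rotated])
    then show "card (?ones A) = card (?h ` ?ones A)" by (simp add: card_image)
    show "?h ` ?ones A \<subseteq> V \<times> W" using fV gW by auto
    fix a b c d
    assume "(a, b) \<in> ?h ` ?ones A" "(c, d) \<in> ?h ` ?ones A" "a \<noteq> c" "b \<noteq> d"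
    then obtain i j i' j' where ij: "a = f i" "b = g j" "c = f i'" "d = g j'"
      "(i, j) \<in> ?ones A" "(i', j') \<in> ?ones A" "i \<noteq> i'" "j \<noteq> j'"
      by auto
    show "(a, d) \<notin> ?h ` ?ones A \<or> (c, b) \<notin> ?h ` ?ones A"
    proof (rule ccontr)
      assume "\<not> ?thesis"
      then have "A $$ (i, j') = 1" "A $$ (i', j) = 1"
        using ij f_eq g_eq by auto
      moreover have "dim_row A = ?m" "dim_col A = ?n" using that by auto
      ultimately have "\<not> no_all_ones_2x2 A"
        \<comment> \<open>The matrix condition speaks of ordered indices, whereas here they are only
          distinct; \<open>min\<close> and \<open>max\<close> put them in order.\<close>
        unfolding no_all_ones_2x2_def not_not using ij(5-8)
        by (intro exI[of _ "min i i'"] exI[of _ "max i i'"] exI[of _ "min j j'"] exI[of _ "max j j'"])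
          (auto simp: min_def max_def)
      then show False using that by simp
    qed
  qed
  moreover have "\<exists>A. card X = card (?ones A) \<and> ?Q A" if X: "?P X" for X
  proof (intro exI conjI)
    \<comment> \<open>The characteristic matrix of \<open>X\<close>, pulled back along the
      enumerations.\<close>
    let ?A = "mat ?m ?n (\<lambda>(i, j). if (f i, g j) \<in> X then 1 else 0 :: nat)"
    have ones: "?ones ?A = {(i, j). i < ?m \<and> j < ?n \<and> (f i, g j) \<in> X}"
      by (auto split: if_splits)
    have "x \<in> ?h ` ?ones ?A" if "x \<in> X" for x
    proof -
      obtain a b where x: "x = (a, b)" "a \<in> V" "b \<in> W" using \<open>x \<in> X\<close> X by (cases x) auto
      then obtain i j where "i < ?m" "a = f i" "j < ?n" "b = g j"
        using f g unfolding bij_betw_def by (metis imageE lessThan_iff)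
      then show ?thesis unfolding ones using x that by force
    qed
    moreover have "?h ` ?ones ?A \<subseteq> X" unfolding ones by auto
    ultimately have X_eq: "X = ?h ` ?ones ?A" by blast
    have "?ones ?A \<subseteq> {..<?m} \<times> {..<?n}" by auto
    then have "inj_on ?h (?ones ?A)" using inj_h by (rule inj_on_subset[rotated])
    then show "card X = card (?ones ?A)"
      by (rule trans[OF arg_cong[OF X_eq, of card] card_image])
    show "?A \<in> carrier_mat ?m ?n" by simp
    show "elements_mat ?A \<subseteq> {0, 1}" by (auto dest!: elements_matD split: if_splits)
    have in_X: "(f i, g j) \<in> X" if "i < ?m" "j < ?n" "?A $$ (i, j) = 1" for i j
      using that by (simp split: if_splits)
    show "no_all_ones_2x2 ?A"
      unfolding no_all_ones_2x2_def
    proof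
      assume "\<exists>i i' j j'. i < i' \<and> i' < dim_row ?A \<and> j < j' \<and> j' < dim_col ?A \<and>
        ?A $$ (i, j) = 1 \<and> ?A $$ (i, j') = 1 \<and> ?A $$ (i', j) = 1 \<and> ?A $$ (i', j') = 1"
      then obtain i i' j j' where less: "i < i'" "i' < ?m" "j < j'" "j' < ?n"
        and entries: "?A $$ (i, j) = 1" "?A $$ (i, j') = 1" "?A $$ (i', j) = 1" "?A $$ (i', j') = 1"
        unfolding dim_row_mat dim_col_mat by (elim exE conjE)
      have "i < ?m" "j < ?n" using less by auto
      then have "(f i, g j) \<in> X" "(f i, g j') \<in> X" "(f i', g j) \<in> X" "(f i', g j') \<in> X"
        using in_X less(2,4) entries by blast+
      moreover have "f i \<noteq> f i'" "g j \<noteq> g j'" using less f_eq g_eq by auto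
      ultimately show False using X by blast
    qed
  qed
  ultimately have "{card (?ones A) | A. ?Q A} = {card X | X. ?P X}" by blast
  then show ?thesis by (simp add: zarankiewicz22_def)
qed

section \<open>Shortest paths and visibility in rook graphs\<close>

locale rook_graph =
  fixes R :: "('a \<times> 'b, 'c) pre_digraph" and V :: "'a set" and W :: "'b set"
  assumes finite_rows: "finite V" and finite_columns: "finite W"
    and verts_rook: "verts R = V \<times> W"
    and arcs_ends_rook: "arcs_ends R = {((a, b), (c, d)). a \<in> V \<and> b \<in> W \<and> c \<in> V \<and> d \<in> W \<and>
      (a = c \<and> b \<noteq> d \<or> a \<noteq> c \<and> b = d)}"
begin

text \<open>The ends share no line, so a path needs a middle vertex. A single middle vertex must
  share a line with each end, which leaves only the two remaining corners of the rectangle.\<close>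

lemma shortest_vpath_iff:
  assumes "a \<in> V" "b \<in> W" "c \<in> V" "d \<in> W" "a \<noteq> c" "b \<noteq> d"
  shows "shortest_vpath R (a, b) (c, d) p \<longleftrightarrow>
    p = [(a, b), (a, d), (c, d)] \<or> p = [(a, b), (c, b), (c, d)]"
proof -
  have path: "vpath [(a, b), (a, d), (c, d)] R" "vpath [(a, b), (c, b), (c, d)] R"
    using assms by (auto simp: vpath_def vwalk_def verts_rook arcs_ends_rook)
  have length: "3 \<le> length q" if "vpath q R" "hd q = (a, b)" "last q = (c, d)" for q
  proof -
    have "q \<noteq> []" using that(1) by auto
    moreover have "q \<noteq> [x]" for x using that(2,3) assms by auto
    moreover have "q \<noteq> [x, y]" for x y
      using that assms by (auto simp: vpath_def vwalk_def arcs_ends_rook)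
    ultimately have "length q \<noteq> 0" "length q \<noteq> 1" "length q \<noteq> 2"
      by (metis length_0_conv One_nat_def length_Suc_conv numeral_2_eq_2)+
    then show ?thesis by linarith
  qed
  show ?thesis
  proof
    assume p: "shortest_vpath R (a, b) (c, d) p"
    then have vp: "vpath p R" "hd p = (a, b)" "last p = (c, d)"
      by (auto simp: shortest_vpath_def)
    have "vwalk_length p \<le> vwalk_length [(a, b), (a, d), (c, d)]"
      using p path(1) unfolding shortest_vpath_def by (metis last.simps list.sel(1) list.simps(3))
    then have "length p = 3" using length[OF vp] by simp
    then obtain x y z where "p = [x, y, z]" by (auto simp: length_Suc_conv numeral_3_eq_3)
    then show "p = [(a, b), (a, d), (c, d)] \<or> p = [(a, b), (c, b), (c, d)]"
      using vp assms by (cases y) (auto simp: vpath_def vwalk_def arcs_ends_rook)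
  next
    assume p: "p = [(a, b), (a, d), (c, d)] \<or> p = [(a, b), (c, b), (c, d)]"
    then have "length p = 3" by auto
    then show "shortest_vpath R (a, b) (c, d) p"
      using p path length by (fastforce simp: shortest_vpath_def)
  qed
qed

text \<open>The \<open>k + 1\<close> paths must be distinct, and only two candidates exist, each
  usable iff its corner is outside \<open>X\<close>. For \<open>k \<ge> 2\<close> the right-hand
  side is false for every pair differing in both coordinates, so no such pair may occur.\<close>

lemma ftmv_set_iff:
  "ftmv_set k R X \<longleftrightarrow> X \<subseteq> V \<times> W \<and>
    (\<forall>a b c d. (a, b) \<in> X \<longrightarrow> (c, d) \<in> X \<longrightarrow> a \<noteq> c \<longrightarrow> b \<noteq> d \<longrightarrow>
      k = 0 \<and> ((a, d) \<notin> X \<or> (c, b) \<notin> X) \<or> k = 1 \<and> (a, d) \<notin> X \<and> (c, b) \<notin> X)"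
proof -
  define paths where "paths u v \<longleftrightarrow> (\<exists>Q. (\<forall>i\<le>k. shortest_vpath R u v (Q i) \<and> set (Q i) \<inter> X = {u, v}) \<and>
    (\<forall>i\<le>k. \<forall>j\<le>k. i \<noteq> j \<longrightarrow> set (Q i) \<inter> set (Q j) = {u, v}))" for u v
  let ?corners = "\<lambda>a b c d.
    k = 0 \<and> ((a, d) \<notin> X \<or> (c, b) \<notin> X) \<or> k = 1 \<and> (a, d) \<notin> X \<and> (c, b) \<notin> X"
  have iff: "paths (a, b) (c, d) \<longleftrightarrow> ?corners a b c d"
    if "X \<subseteq> V \<times> W" "(a, b) \<in> X" "(c, d) \<in> X" "a \<noteq> c" "b \<noteq> d" for a b c d
  proof -
    define p1 where "p1 = [(a, b), (a, d), (c, d)]"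
    define p2 where "p2 = [(a, b), (c, b), (c, d)]"
    have short: "shortest_vpath R (a, b) (c, d) p \<longleftrightarrow> p = p1 \<or> p = p2" for p
      unfolding p1_def p2_def using that by (intro shortest_vpath_iff) auto
    have p1: "set p1 \<inter> X = {(a, b), (c, d)} \<longleftrightarrow> (a, d) \<notin> X"
      and p2: "set p2 \<inter> X = {(a, b), (c, d)} \<longleftrightarrow> (c, b) \<notin> X"
      and disj: "set p1 \<inter> set p2 = {(a, b), (c, d)}"
      \<comment> \<open>A path meets itself in its corner too, so it cannot serve for two indices;
        this is what makes the \<open>Q i\<close> distinct below.\<close>
      and self: "set p1 \<noteq> {(a, b), (c, d)}" "set p2 \<noteq> {(a, b), (c, d)}"
      using that by (auto simp: p1_def p2_def)
    show ?thesis
    proof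
      assume "paths (a, b) (c, d)"
      then obtain Q where
        *: "\<forall>i\<le>k. shortest_vpath R (a, b) (c, d) (Q i) \<and> set (Q i) \<inter> X = {(a, b), (c, d)}"
          "\<forall>i\<le>k. \<forall>j\<le>k. i \<noteq> j \<longrightarrow> set (Q i) \<inter> set (Q j) = {(a, b), (c, d)}"
        unfolding paths_def by (elim exE conjE)
      have Q: "Q i = p1 \<or> Q i = p2" "set (Q i) \<inter> X = {(a, b), (c, d)}" if "i \<le> k" for i
        using *(1) that unfolding short by simp_all
      have inj: "Q i \<noteq> Q j" if "i \<le> k" "j \<le> k" "i \<noteq> j" for i j
      proof
        assume "Q i = Q j"
        then have "set (Q i) = {(a, b), (c, d)}" using *(2) that by (metis Int_absorb)
        then show False using Q(1)[OF that(1)] self by metis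
      qed
      consider "k = 0" | "k = 1" | "k \<ge> 2" by linarith
      then show "?corners a b c d"
      proof cases
        case 1
        then show ?thesis using Q[of 0] p1 p2 by (metis le0)
      next
        case 2
        then have "Q 0 \<noteq> Q 1" by (intro inj) auto
        then have "set p1 \<inter> X = {(a, b), (c, d)}" "set p2 \<inter> X = {(a, b), (c, d)}"
          using Q[of 0] Q[of 1] 2 by (metis le0 order_refl)+
        then show ?thesis using p1 p2 2 by blast
      next
        \<comment> \<open>Pigeonhole: three pairwise distinct paths among \<open>p1\<close> and
          \<open>p2\<close>.\<close>
        case 3
        then have "Q 0 \<noteq> Q 1" "Q 0 \<noteq> Q 2" "Q 1 \<noteq> Q 2"
          using inj[of 0 1] inj[of 0 2] inj[of 1 2] by simp_all
        moreover have "Q 0 = p1 \<or> Q 0 = p2" "Q 1 = p1 \<or> Q 1 = p2" "Q 2 = p1 \<or> Q 2 = p2"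
          using 3 by (auto intro!: Q(1))
        ultimately show ?thesis by metis
      qed
    next
      assume "?corners a b c d"
      then consider "k = 0" "(a, d) \<notin> X" | "k = 0" "(c, b) \<notin> X" | "k = 1" "(a, d) \<notin> X" "(c, b) \<notin> X"
        by blast
      then show "paths (a, b) (c, d)"
      proof cases
        case 1
        then show ?thesis
          unfolding paths_def by (intro exI[of _ "\<lambda>_. p1"]) (simp add: short p1)
      next
        case 2
        then show ?thesis
          unfolding paths_def by (intro exI[of _ "\<lambda>_. p2"]) (simp add: short p2)
      next
        case 3
        have "set p2 \<inter> set p1 = {(a, b), (c, d)}" using disj by (simp only: Int_commute)
        then show ?thesis
          using 3 p1 p2 disj unfolding paths_def
          by (intro exI[of _ "\<lambda>i. if i = 0 then p1 else p2"]) (simp add: short)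
      qed
    qed
  qed
  have adj: "(a, b) \<noteq> (c, d) \<and> ((a, b), (c, d)) \<notin> arcs_ends R \<longleftrightarrow> a \<noteq> c \<and> b \<noteq> d"
    if "X \<subseteq> V \<times> W" "(a, b) \<in> X" "(c, d) \<in> X" for a b c d
    using that by (auto simp: arcs_ends_rook)
  show ?thesis
    unfolding ftmv_set_def verts_rook paths_def[symmetric]
  \<comment> \<open>The congruence rule makes \<open>X \<subseteq> V \<times> W\<close> available,
    which \<open>iff\<close> and \<open>adj\<close> require.\<close>
  proof (rule conj_cong[OF refl], goal_cases)
    case 1
    show ?case
    proof (intro iffI allI impI ballI)
      fix a b c d
      assume "\<forall>u\<in>X. \<forall>v\<in>X. u \<noteq> v \<and> (u, v) \<notin> arcs_ends R \<longrightarrow> paths u v"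
        and ad: "(a, b) \<in> X" "(c, d) \<in> X" "a \<noteq> c" "b \<noteq> d"
      then have "paths (a, b) (c, d)" using adj[OF 1 ad(1,2)] by blast
      then show "?corners a b c d" using iff[OF 1 ad] by simp
    next
      fix u v
      assume *: "\<forall>a b c d. (a, b) \<in> X \<longrightarrow> (c, d) \<in> X \<longrightarrow> a \<noteq> c \<longrightarrow> b \<noteq> d \<longrightarrow> ?corners a b c d"
        and uv: "u \<in> X" "v \<in> X" "u \<noteq> v \<and> (u, v) \<notin> arcs_ends R"
      obtain a b c d where [simp]: "u = (a, b)" "v = (c, d)" by (cases u, cases v)
      have "a \<noteq> c" "b \<noteq> d" using uv adj[OF 1, of a b c d] by simp_all
      moreover from this have "?corners a b c d" using * uv(1,2) by simp
      ultimately show "paths u v" using iff[OF 1, of a b c d] uv(1,2) by simp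
    qed
  qed
qed

section \<open>The values for \<open>k = 0\<close>, \<open>k = 1\<close> and
  \<open>k \<ge> 2\<close>\<close>

lemma finite_squares: "finite (V \<times> W)"
  using finite_rows finite_columns by simp

lemma ftmv_number_0: "ftmv_number 0 R = zarankiewicz22 (card V) (card W)"
  unfolding ftmv_number_def zarankiewicz22_eq_Max[OF finite_rows finite_columns] ftmv_set_iff
  by simp

lemma ftmv_number_1:
  assumes "card V \<ge> 2" "card W \<ge> 2"
  shows "ftmv_number 1 R = card V + card W - 2"
  unfolding ftmv_number_def
proof (rule Max_eqI_card[OF finite_squares])
  define a b where "a = (SOME a. a \<in> V)" and "b = (SOME b. b \<in> W)"
  have "V \<noteq> {}" "W \<noteq> {}" using assms by auto
  then have ab: "a \<in> V" "b \<in> W" unfolding a_def b_def by (simp_all add: some_in_eq)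
  \<comment> \<open>A row and a column without their crossing. Two positions in different arms have
    as other corners the removed crossing and a position off both lines.\<close>
  let ?Y = "{a} \<times> (W - {b}) \<union> (V - {a}) \<times> {b}"
  show "ftmv_set 1 R ?Y" using ab by (auto simp: ftmv_set_iff)
  have "card ?Y = (card W - 1) + (card V - 1)"
    using ab finite_rows finite_columns
    by (subst card_Un_disjoint) (auto simp: card_cartesian_product)
  then show "card ?Y = card V + card W - 2" using assms by simp
  fix X assume X: "ftmv_set 1 R X"
  have corners: "(a, d) \<notin> X \<and> (c, b) \<notin> X"
    if "(a, b) \<in> X" "(c, d) \<in> X" "a \<noteq> c" "b \<noteq> d" for a b c d
    using X that unfolding ftmv_set_iff by (metis one_neq_zero)
  have "X \<subseteq> V \<times> W" using X by (simp add: ftmv_set_iff)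
  then show "card X \<le> card V + card W - 2"
    using corners by (rule card_le_if_no_three_corners[OF finite_rows finite_columns assms])
qed (auto simp: ftmv_set_iff)

lemma ftmv_number_ge_2:
  assumes "k \<ge> 2" "V \<noteq> {}" "W \<noteq> {}"
  shows "ftmv_number k R = max (card V) (card W)"
  unfolding ftmv_number_def
proof (rule Max_eqI_card[OF finite_squares])
  define a b where "a = (SOME a. a \<in> V)" and "b = (SOME b. b \<in> W)"
  have ab: "a \<in> V" "b \<in> W" using assms unfolding a_def b_def by (simp_all add: some_in_eq)
  \<comment> \<open>A full line of the larger size; no two of its positions differ in both
    coordinates.\<close>
  let ?Y = "if card V \<le> card W then {a} \<times> W else V \<times> {b}"
  show "ftmv_set k R ?Y" using ab by (auto simp: ftmv_set_iff)
  show "card ?Y = max (card V) (card W)" by (simp add: card_cartesian_product)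
  fix X assume X: "ftmv_set k R X"
  have "k \<noteq> 0" "k \<noteq> 1" using assms(1) by auto
  then have "X \<subseteq> V \<times> W" "\<And>a b c d. (a, b) \<in> X \<Longrightarrow> (c, d) \<in> X \<Longrightarrow> a = c \<or> b = d"
    using X unfolding ftmv_set_iff by blast+
  then show "card X \<le> max (card V) (card W)"
    by (rule card_le_card_line[OF finite_rows finite_columns])
qed (auto simp: ftmv_set_iff)

end

theorem theorem7p1:
  fixes k m n :: nat
    and G :: "'a pair_pre_digraph" and H :: "'b pair_pre_digraph"
  assumes "m \<ge> 2" and "n \<ge> 2"
    and "complete_digraph m (with_proj G)" and "complete_digraph n (with_proj H)"
  shows "ftmv_number k (with_proj (G \<box> H)) =
    (if k = 0 then zarankiewicz22 m n
     else if k = 1 then m + n - 2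
     else max m n)"
proof -
  \<comment> \<open>Distinct vertices of a complete factor are adjacent, so two vertices of the
    product are adjacent exactly when they differ in one coordinate only.\<close>
  interpret rook_graph "with_proj (G \<box> H)" "pverts G" "pverts H"
    using assms(3,4)
    by unfold_locales (auto simp: complete_digraph_pair_def cartesian_product_def)
  have card: "card (pverts G) = m" "card (pverts H) = n"
    using assms(3,4) by (auto simp: complete_digraph_pair_def)
  then have "pverts G \<noteq> {}" "pverts H \<noteq> {}" using assms(1,2) by auto
  then show ?thesis
    using ftmv_number_0 ftmv_number_1 ftmv_number_ge_2[of k] card assms(1,2) by auto
qed

end
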